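(* Let $p$ be a positive real number and $G$ be a connected graph with $n$ vertices and $m$ edges. Then $$BH(G)\geq n\left(\frac{(2m)^{p+1}}{\sum_{i=2}^{n}\lambda_i^{3p+1}}\right)^{\frac{1}{p}}$$ with equality if and only if $G\cong K_n$.
   Context: For a graph $G$ on $n$ vertices, $L(G)=D(G)-A(G)$ is its Laplacian matrix with eigenvalues $0=\lambda_1\le\lambda_2\le\cdots\le\lambda_n$ (for connected $G$ with $n\ge 2$, $\lambda_2>0$). The biharmonic index is $BH(G)=\frac12\sum_{u,v\in V(G)}d_B^2(u,v)$ with $d_B^2$ the squared biharmonic distance; equivalently $BH(G)=n\sum_{i=2}^n\lambda_i^{-2}$. $K_n$ is the complete graph. *)

theory Defs
  imports
    Complex_Main
    "HOL-Library.Countable_Set"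
    "Graph_Theory.Graph_Theory"
    "Jordan_Normal_Form.Char_Poly"
begin

text \<open>
  A finite simple graph is a symmetric, loop-free digraph without multiple arcs (the locale
  \<^locale>\<open>graph\<close>): an undirected edge is a pair of opposite arcs.
\<close>

definition edges :: "('a, 'b) pre_digraph \<Rightarrow> 'a set set" where
  "edges G = {{u, v} | u v. u \<rightarrow>\<^bsub>G\<^esub> v}"

definition complete_graph :: "nat \<Rightarrow> (nat, nat \<times> nat) pre_digraph" where
  "complete_graph n =
     \<lparr>verts = {..<n}, arcs = {(i, j). i < n \<and> j < n \<and> i \<noteq> j}, tail = fst, head = snd\<rparr>"

lemma complete_digraph_complete_graph: "complete_digraph n (complete_graph n)"
proof -
  let ?G = "complete_graph n"
  have ends: "arcs_ends ?G = {(i, j). i < n \<and> j < n \<and> i \<noteq> j}"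
    by (simp add: arcs_ends_conv complete_graph_def)
  have "finite (arcs ?G)"
    by (rule finite_subset[of _ "{..<n} \<times> {..<n}"]) (auto simp: complete_graph_def)
  then have "graph ?G"
    by unfold_locales
      (auto simp: complete_graph_def symmetric_conv arc_to_ends_def prod_eq_iff)
  then show ?thesis
    unfolding complete_digraph_def ends by (auto simp: complete_graph_def)
qed

text \<open>
  Rows and columns of the matrices below are indexed through the bijection
  \<^term>\<open>to_nat_on (verts G)\<close> between the (finite) vertex set and
  \<^term>\<open>{..<card (verts G)}\<close>, whose inverse is \<^term>\<open>from_nat_into (verts G)\<close>.
\<close>

definition adjacency_mat :: "('a, 'b) pre_digraph \<Rightarrow> real mat" where
  "adjacency_mat G = mat (card (verts G)) (card (verts G))
     (\<lambda>(i, j). if from_nat_into (verts G) i \<rightarrow>\<^bsub>G\<^esub> from_nat_into (verts G) j then 1 else 0)"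

definition degree_mat :: "('a, 'b) pre_digraph \<Rightarrow> real mat" where
  "degree_mat G = mat (card (verts G)) (card (verts G))
     (\<lambda>(i, j). if i = j then real (out_degree G (from_nat_into (verts G) i)) else 0)"

definition laplacian :: "('a, 'b) pre_digraph \<Rightarrow> real mat" where
  "laplacian G = degree_mat G - adjacency_mat G"

text \<open>
  The eigenvalues are listed in nondecreasing order with algebraic multiplicity and numbered
  from 1.
\<close>

definition laplacian_eigenvalue :: "('a, 'b) pre_digraph \<Rightarrow> nat \<Rightarrow> real" where
  "laplacian_eigenvalue G i =
     sorted_list_of_multiset (proots (char_poly (laplacian G))) ! (i - 1)"

text \<open>The Moore--Penrose inverse of a real matrix, given by the four Penrose equations.\<close>

definition is_pseudoinverse :: "real mat \<Rightarrow> real mat \<Rightarrow> bool" where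
  "is_pseudoinverse A X \<longleftrightarrow>
     X \<in> carrier_mat (dim_col A) (dim_row A) \<and>
     A * X * A = A \<and>
     X * A * X = X \<and>
     transpose_mat (A * X) = A * X \<and>
     transpose_mat (X * A) = X * A"

definition pseudoinverse :: "real mat \<Rightarrow> real mat" where
  "pseudoinverse A = (THE X. is_pseudoinverse A X)"

text \<open>
  The squared biharmonic distance is obtained from the square of the Moore--Penrose inverse of
  the Laplacian in the same way as the resistance distance is from the Moore--Penrose inverse
  itself.
\<close>

definition biharmonic_dist_sq :: "('a, 'b) pre_digraph \<Rightarrow> 'a \<Rightarrow> 'a \<Rightarrow> real" where
  "biharmonic_dist_sq G u v =
     (let M = pseudoinverse (laplacian G) * pseudoinverse (laplacian G);
          i = to_nat_on (verts G) u;
          j = to_nat_on (verts G) v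
      in M $$ (i, i) + M $$ (j, j) - 2 * M $$ (i, j))"

definition biharmonic_index :: "('a, 'b) pre_digraph \<Rightarrow> real" where
  "biharmonic_index G = (\<Sum>u\<in>verts G. \<Sum>v\<in>verts G. biharmonic_dist_sq G u v) / 2"

end

theory Submission
  imports
    Defs
    "Jordan_Normal_Form.Schur_Decomposition"
begin

text \<open>
  Writing the Laplacian as $P \,\mathrm{diag}(\lambda)\, P^T$ with $P$ orthogonal, the squared
  pseudoinverse is $P \,\mathrm{diag}(\lambda^{-2})\, P^T$ with $0^{-1}=0$, and since its rows
  sum to zero, $BH(G) = n \sum_{i \ge 2} \lambda_i^{-2}$. Hoelder's inequality applied to
  $\lambda_i = (\lambda_i^{-2})^{p/(p+1)} (\lambda_i^{3p+1})^{1/(p+1)}$, whose sum is $2m$, gives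
  the bound. Equality forces all nonzero eigenvalues to coincide, so the Laplacian is
  $\mu (I - J/n)$ and has no zero off the diagonal.
\<close>

section \<open>Real symmetric matrices\<close>

text \<open>The Hoelder exponents are \<open>(p + 1) / p\<close> and \<open>p + 1\<close>. The
  number \<open>3 * p + 1\<close> is forced by them: -2p/(p+1) + (3p+1)/(p+1) = 1, so the two
  factors multiply to the eigenvalue itself, whose sum is a trace and hence known. The
  diagonalisation lists the eigenvalues in no particular order, so the zero eigenvalue sits at an
  unknown index \<open>k0\<close>, and sums over 2..n become sums over all indices except
  \<open>k0\<close>. Connectedness makes \<open>k0\<close> the only zero; all other eigenvalues are
  positive, as the powers with negative exponent require. Both directions of the equality case use
  the eigenvector entries and not only the spectrum. Column \<open>k0\<close> of \<open>P\<close> is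
  constant with entry c, so a common nonzero eigenvalue \<mu> makes every off-diagonal Laplacian
  entry equal to -\<mu> c^2, which is nonzero. Conversely, in a complete graph the Laplacian
  multiplies each column with zero sum by n, so no characteristic polynomial has to be
  computed.\<close>

lemma real_symmetric_eigenvalue_exists:
  fixes A :: "real mat"
  assumes A: "A \<in> carrier_mat n n" and sym: "transpose_mat A = A" and n: "n > 0"
  shows "\<exists>e. eigenvalue A e"
proof -
  define C where "C = map_mat complex_of_real A"
  have C: "C \<in> carrier_mat n n" using A by (simp add: C_def)
  obtain as where as: "char_poly C = (\<Prod>a\<leftarrow>as. [:- a, 1:])" "length as = n"
    using char_poly_factorized[OF C] by blast
  then obtain a where "a \<in> set as" using n by (cases as) auto
  then have root: "poly (char_poly C) a = 0"
    unfolding as(1) poly_prod_list by (force simp: prod_list_zero_iff)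
  then obtain v where v: "v \<in> carrier_vec n" "v \<noteq> 0\<^sub>v n" "C *\<^sub>v v = a \<cdot>\<^sub>v v"
    using eigenvalue_root_char_poly[OF C] C unfolding eigenvalue_def eigenvector_def by auto
  have Asym: "A $$ (i, j) = A $$ (j, i)" if "i < n" "j < n" for i j
    using that A arg_cong[OF sym, of "\<lambda>M. M $$ (i, j)"] by auto
  have ev: "(\<Sum>j<n. of_real (A $$ (i, j)) * v $ j) = a * v $ i" if "i < n" for i
    using arg_cong[OF v(3), of "\<lambda>w. w $ i"] that A v(1)
    by (simp add: C_def scalar_prod_def lessThan_atLeast0)
  \<comment> \<open>\<open>S\<close> is the Hermitian form v* A v. It equals \<open>a * N\<close>
    with \<open>N\<close> the squared norm of \<open>v\<close>, and symmetry of the real matrix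
    makes it self-conjugate; hence the complex root \<open>a\<close> is real.\<close>
  define S where "S = (\<Sum>i<n. \<Sum>j<n. of_real (A $$ (i, j)) * v $ j * cnj (v $ i))"
  define N where "N = (\<Sum>i<n. (cmod (v $ i))\<^sup>2)"
  have S: "S = a * of_real N"
  proof -
    have "S = (\<Sum>i<n. (\<Sum>j<n. of_real (A $$ (i, j)) * v $ j) * cnj (v $ i))"
      by (simp add: S_def sum_distrib_right)
    also have "\<dots> = (\<Sum>i<n. a * of_real ((cmod (v $ i))\<^sup>2))"
      by (intro sum.cong refl) (simp only: ev lessThan_iff mult.assoc complex_norm_square)
    finally show ?thesis by (simp add: N_def sum_distrib_left)
  qed
  have "cnj S = (\<Sum>i<n. \<Sum>j<n. of_real (A $$ (i, j)) * cnj (v $ j) * v $ i)"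
    by (simp add: S_def)
  also have "\<dots> = (\<Sum>j<n. \<Sum>i<n. of_real (A $$ (i, j)) * cnj (v $ j) * v $ i)"
    by (rule sum.swap)
  also have "\<dots> = S"
    unfolding S_def by (intro sum.cong refl) (simp add: Asym mult_ac)
  finally have cnjS: "cnj S = S" .
  obtain i where "i < n" "v $ i \<noteq> 0" using v(1,2) by (metis carrier_vecD eq_vecI index_zero_vec)
  then have "N > 0" unfolding N_def by (intro sum_pos2[of _ i]) auto
  then have "cnj a = a" using cnjS unfolding S by simp
  then obtain r where r: "a = of_real r" by (metis Reals_cases Reals_cnj_iff)
  have "poly (map_poly of_real (char_poly A)) (of_real r :: complex) = 0"
    using root unfolding C_def r of_real_hom.char_poly_hom[OF A] .
  then have "poly (char_poly A) r = 0" by simp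
  then show ?thesis using eigenvalue_root_char_poly[OF A] by blast
qed

text \<open>Gram-Schmidt leaves the first vector of a basis unchanged, so only the normalisation of
  the columns rescales \<open>v\<close>, by the factor c. With \<open>v\<close> an eigenvector this
  provides the change of basis for one deflation step.\<close>

lemma orthonormal_completion:
  fixes v :: "real vec"
  assumes v: "v \<in> carrier_vec n" "v \<noteq> 0\<^sub>v n"
  shows "\<exists>W c. W \<in> carrier_mat n n \<and> transpose_mat W * W = 1\<^sub>m n \<and> col W 0 = c \<cdot>\<^sub>v v"
proof -
  interpret cof_vec_space n "TYPE(real)" .
  define ws where "ws = gram_schmidt n (basis_completion v)"
  note bc = basis_completion[OF v]
  have ws: "set ws \<subseteq> carrier_vec n" "corthogonal ws" "length ws = n"
    using gram_schmidt_result[OF bc(2,4,5) ws_def] bc(6) by auto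
  have n: "n > 0" using v by (cases n) auto
  obtain vs where "basis_completion v = v # vs" using bc(6,7) n by (cases "basis_completion v") auto
  then have hd: "hd ws = v" unfolding ws_def using gram_schmidt_hd[OF v(1)] by simp
  define r where "r j = sqrt (ws ! j \<bullet> ws ! j)" for j
  define W where "W = mat n n (\<lambda>(i, j). ws ! j $ i / r j)"
  have wsc: "ws ! j \<in> carrier_vec n" if "j < n" for j using ws that by auto
  \<comment> \<open>Over the reals \<open>corthogonal\<close> is ordinary orthogonality; it also
    says that each vector has nonzero product with itself, which makes the division by
    \<open>r j\<close> legitimate.\<close>
  have conj: "conjugate w = w" for w :: "real vec" by (intro eq_vecI) auto
  have orth: "ws ! i \<bullet> ws ! j = 0 \<longleftrightarrow> i \<noteq> j" if "i < n" "j < n" for i j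
    using ws(2,3) that unfolding corthogonal_def conj by auto
  have nonneg: "w \<bullet> w \<ge> 0" for w :: "real vec" by (simp add: scalar_prod_def sum_nonneg)
  have r: "r j * r j = ws ! j \<bullet> ws ! j" for j using nonneg by (simp add: r_def)
  have entry: "(transpose_mat W * W) $$ (i, j) = ws ! i \<bullet> ws ! j / (r i * r j)" if "i < n" "j < n" for i j
    using that wsc[OF that(1)] wsc[OF that(2)] by (simp add: W_def scalar_prod_def sum_divide_distrib carrier_vecD[OF wsc])
  have "transpose_mat W * W = 1\<^sub>m n"
  proof (rule eq_matI)
    fix i j assume "i < dim_row (1\<^sub>m n :: real mat)" "j < dim_col (1\<^sub>m n :: real mat)"
    then have ij: "i < n" "j < n" by auto
    show "(transpose_mat W * W) $$ (i, j) = 1\<^sub>m n $$ (i, j)"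
      unfolding entry[OF ij] using orth[OF ij] r ij by auto
  qed (auto simp: W_def)
  moreover have "col W 0 = (1 / r 0) \<cdot>\<^sub>v v"
  proof -
    have "ws ! 0 = v" using hd ws(3) n by (cases ws) auto
    then show ?thesis using v n by (intro eq_vecI) (auto simp: W_def)
  qed
  moreover have "W \<in> carrier_mat n n" by (simp add: W_def)
  ultimately show ?thesis by blast
qed

text \<open>Deflation: in an orthonormal basis that starts with an eigenvector, the first column of
  the matrix is a multiple of the first unit vector. Symmetry gives the same for the first row, so
  the matrix splits into the eigenvalue and a smaller symmetric block.\<close>

theorem real_spectral_theorem:
  fixes A :: "real mat"
  assumes "A \<in> carrier_mat n n" "transpose_mat A = A"
  shows "\<exists>P f. P \<in> carrier_mat n n \<and> transpose_mat P * P = 1\<^sub>m n \<and>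
    transpose_mat P * A * P = mat_diag n f"
  using assms
proof (induction n arbitrary: A)
  case 0
  show ?case by (rule exI[of _ "1\<^sub>m 0"], rule exI[of _ "\<lambda>_. 0"]) (use 0 in \<open>auto simp: mat_diag_def\<close>)
next
  case (Suc n)
  note A = Suc.prems(1) and sym = Suc.prems(2)
  let ?n = "Suc n"
  obtain e where "eigenvalue A e" using real_symmetric_eigenvalue_exists[OF A sym] by auto
  then obtain v where v: "v \<in> carrier_vec ?n" "v \<noteq> 0\<^sub>v ?n" "A *\<^sub>v v = e \<cdot>\<^sub>v v"
    using A unfolding eigenvalue_def eigenvector_def by auto
  obtain W c where W: "W \<in> carrier_mat ?n ?n" "transpose_mat W * W = 1\<^sub>m ?n" "col W 0 = c \<cdot>\<^sub>v v"
    using orthonormal_completion[OF v(1,2)] by blast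
  define B where "B = transpose_mat W * A * W"
  have WT: "transpose_mat W \<in> carrier_mat ?n ?n" using W by simp
  have B: "B \<in> carrier_mat ?n ?n" using A W unfolding B_def by auto
  have Bsym: "transpose_mat B = B"
    unfolding B_def using A W WT sym
    by (simp add: transpose_mult[of _ ?n ?n _ ?n] assoc_mult_mat[of _ ?n ?n _ ?n _ ?n])
  have colB: "col B 0 = e \<cdot>\<^sub>v unit_vec ?n 0"
  proof -
    have "B = transpose_mat W * (A * W)" using A W WT by (simp add: B_def)
    then have "col B 0 = col (transpose_mat W * (A * W)) 0" by simp
    also have "\<dots> = transpose_mat W *\<^sub>v col (A * W) 0"
      using A W(1) WT by (intro col_mult2[of _ ?n ?n _ ?n]) auto
    also have "col (A * W) 0 = A *\<^sub>v col W 0"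
      using A W(1) by (intro col_mult2[of _ ?n ?n _ ?n]) auto
    also have "\<dots> = e \<cdot>\<^sub>v col W 0"
      unfolding W(3) using A v by (simp add: mult_mat_vec smult_smult_assoc mult.commute)
    also have "transpose_mat W *\<^sub>v (e \<cdot>\<^sub>v col W 0) = e \<cdot>\<^sub>v (transpose_mat W *\<^sub>v col W 0)"
      using W(1) col_dim[of W 0] by (intro mult_mat_vec[OF WT]) auto
    also have "transpose_mat W *\<^sub>v col W 0 = col (1\<^sub>m ?n) 0"
      unfolding W(2)[symmetric] using W(1) WT by (intro col_mult2[of _ ?n ?n _ ?n, symmetric]) auto
    finally show ?thesis by simp
  qed
  have B0: "B $$ (i, 0) = (if i = 0 then e else 0)" if "i < ?n" for i
    using arg_cong[OF colB, of "\<lambda>w. w $ i"] that B by auto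
  have B0': "B $$ (0, i) = (if i = 0 then e else 0)" if "i < ?n" for i
    using B0[OF that] arg_cong[OF Bsym, of "\<lambda>M. M $$ (i, 0)"] that B by auto
  define B3 where "B3 = mat n n (\<lambda>(i, j). B $$ (Suc i, Suc j))"
  have B3: "B3 \<in> carrier_mat n n" by (simp add: B3_def)
  have "B $$ (i, j) = B $$ (j, i)" if "i < ?n" "j < ?n" for i j
    using that B arg_cong[OF Bsym, of "\<lambda>M. M $$ (i, j)"] by auto
  then have "transpose_mat B3 = B3" by (intro eq_matI) (auto simp: B3_def)
  then obtain P f where P: "P \<in> carrier_mat n n" "transpose_mat P * P = 1\<^sub>m n"
    "transpose_mat P * B3 * P = mat_diag n f"
    using Suc.IH[OF B3] by blast
  let ?e = "mat 1 1 (\<lambda>_. e)"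
  have Bblock: "B = four_block_mat ?e (0\<^sub>m 1 n) (0\<^sub>m n 1) B3"
    using B B0 B0' by (intro eq_matI) (auto simp: B3_def)
  \<comment> \<open>\<open>Q\<close> fixes the eigenvector found first and diagonalises the
    remaining block, so \<open>W * Q\<close> is the required orthogonal matrix.\<close>
  define Q where "Q = four_block_mat (1\<^sub>m 1) (0\<^sub>m 1 n) (0\<^sub>m n 1) P"
  have Q: "Q \<in> carrier_mat ?n ?n" unfolding Q_def
    using four_block_carrier_mat[OF one_carrier_mat[of 1] P(1)] by simp
  have QT: "transpose_mat Q = four_block_mat (1\<^sub>m 1) (0\<^sub>m 1 n) (0\<^sub>m n 1) (transpose_mat P)"
    unfolding Q_def using P(1) by (subst transpose_four_block_mat) auto
  have PT: "transpose_mat P \<in> carrier_mat n n" using P by simp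
  have QTc: "transpose_mat Q \<in> carrier_mat ?n ?n" using Q by simp
  have QQ: "transpose_mat Q * Q = 1\<^sub>m ?n"
    unfolding QT unfolding Q_def
    using P PT by (subst mult_four_block_mat[of _ 1 1 _ n _ n]) auto
  have QBQ: "transpose_mat Q * B * Q = mat_diag ?n (case_nat e f)"
  proof -
    have "transpose_mat Q * B * Q = four_block_mat ?e (0\<^sub>m 1 n) (0\<^sub>m n 1) (mat_diag n f)"
      unfolding QT Bblock unfolding Q_def P(3)[symmetric] using P(1) PT B3
      by (subst mult_four_block_mat[of _ 1 1 _ n _ n], auto)+
    also have "\<dots> = mat_diag ?n (case_nat e f)"
      by (intro eq_matI) (auto simp: mat_diag_def split: nat.split)
    finally show ?thesis .
  qed
  have "transpose_mat (W * Q) * (W * Q) = transpose_mat Q * (transpose_mat W * W) * Q"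
    using W(1) WT Q QTc by (simp add: transpose_mult[of _ ?n ?n _ ?n] assoc_mult_mat[of _ ?n ?n _ ?n _ ?n])
  also have "\<dots> = 1\<^sub>m ?n" using W(2) QQ QTc by simp
  finally have 1: "transpose_mat (W * Q) * (W * Q) = 1\<^sub>m ?n" .
  have "transpose_mat (W * Q) * A * (W * Q) = transpose_mat Q * B * Q"
    using W(1) WT Q QTc A unfolding B_def
    by (simp add: transpose_mult[of _ ?n ?n _ ?n] assoc_mult_mat[of _ ?n ?n _ ?n _ ?n])
  then have 2: "transpose_mat (W * Q) * A * (W * Q) = mat_diag ?n (case_nat e f)" using QBQ by simp
  have "W * Q \<in> carrier_mat ?n ?n" using W Q by auto
  with 1 2 show ?case by blast
qed

section \<open>The Moore--Penrose inverse and the spectrum of a diagonalised matrix\<close>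

text \<open>\<open>A * X\<close> and \<open>A * Y\<close> are symmetric, and each absorbs the other
  by A X A = A = A Y A; transposing the product shows that they coincide. The same holds for
  \<open>X * A\<close> and \<open>Y * A\<close>. Uniqueness is what gives the definite description
  \<open>pseudoinverse\<close> a value.\<close>

lemma is_pseudoinverse_unique:
  assumes X: "is_pseudoinverse A X" and Y: "is_pseudoinverse A Y"
  shows "X = Y"
proof -
  let ?r = "dim_row A" and ?c = "dim_col A"
  have A: "A \<in> carrier_mat ?r ?c" by simp
  have Xc: "X \<in> carrier_mat ?c ?r" and AXA: "A * X * A = A" and XAX: "X * A * X = X"
    and AXt: "transpose_mat (A * X) = A * X" and XAt: "transpose_mat (X * A) = X * A"
    using X by (auto simp: is_pseudoinverse_def)
  have Yc: "Y \<in> carrier_mat ?c ?r" and AYA: "A * Y * A = A" and YAY: "Y * A * Y = Y"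
    and AYt: "transpose_mat (A * Y) = A * Y" and YAt: "transpose_mat (Y * A) = Y * A"
    using Y by (auto simp: is_pseudoinverse_def)
  have AX: "A * X \<in> carrier_mat ?r ?r" and AY: "A * Y \<in> carrier_mat ?r ?r"
    and XA: "X * A \<in> carrier_mat ?c ?c" and YA: "Y * A \<in> carrier_mat ?c ?c" using Xc Yc by auto
  have 1: "A * X = A * Y"
  proof -
    have "A * X = (A * Y * A) * X" by (simp add: AYA)
    also have "\<dots> = (A * Y) * (A * X)" using AY Xc by (simp add: assoc_mult_mat[of _ ?r ?r _ ?c _ ?r])
    also have "\<dots> = transpose_mat ((A * X) * (A * Y))"
      using AX AY by (simp add: transpose_mult[of _ ?r ?r _ ?r] AXt AYt)
    also have "(A * X) * (A * Y) = (A * X * A) * Y"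
      using AX Yc by (simp add: assoc_mult_mat[of _ ?r ?r _ ?c _ ?r])
    finally show ?thesis by (simp add: AXA AYt)
  qed
  have 2: "X * A = Y * A"
  proof -
    have "X * A = X * (A * Y * A)" by (simp add: AYA)
    also have "\<dots> = (X * A) * (Y * A)"
      using Xc Yc AY YA by (simp add: assoc_mult_mat[of _ ?r ?c _ ?r _ ?c] assoc_mult_mat[of _ ?c ?r _ ?c _ ?c])
    also have "\<dots> = transpose_mat ((Y * A) * (X * A))"
      using XA YA by (simp add: transpose_mult[of _ ?c ?c _ ?c] XAt YAt)
    also have "(Y * A) * (X * A) = Y * (A * X * A)"
      using Xc Yc AX XA by (simp add: assoc_mult_mat[of _ ?r ?c _ ?r _ ?c] assoc_mult_mat[of _ ?c ?r _ ?c _ ?c])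
    finally show ?thesis by (simp add: AXA YAt)
  qed
  have "X = X * A * X" by (simp add: XAX)
  also have "\<dots> = Y * A * X" by (simp add: 2)
  also have "\<dots> = Y * (A * X)" using Xc Yc by (intro assoc_mult_mat) auto
  also have "\<dots> = Y * A * Y" using Yc by (simp add: 1 assoc_mult_mat[of _ ?c ?r _ ?c _ ?r])
  finally show ?thesis by (simp add: YAY)
qed

lemma pseudoinverse_eqI: "is_pseudoinverse A X \<Longrightarrow> pseudoinverse A = X"
  unfolding pseudoinverse_def using is_pseudoinverse_unique by blast

lemma index_conj_mat_diag:
  fixes P :: "'a :: comm_ring_1 mat"
  assumes "P \<in> carrier_mat n n" "i < n" "j < n"
  shows "(P * mat_diag n f * transpose_mat P) $$ (i, j) =
    (\<Sum>k<n. f k * P $$ (i, k) * P $$ (j, k))"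
  using assms
  by (simp add: mat_diag_mult_right[OF assms(1)] scalar_prod_def lessThan_atLeast0 mult_ac)

lemma orthonormal_col_sum:
  assumes "P \<in> carrier_mat n n" "transpose_mat P * P = 1\<^sub>m n" "k < n" "l < n"
  shows "(\<Sum>i<n. P $$ (i, k) * P $$ (i, l)) = (if k = l then 1 else 0)"
  using arg_cong[OF assms(2), of "\<lambda>M. M $$ (k, l)"] assms(1,3,4)
  by (simp add: scalar_prod_def lessThan_atLeast0)

lemma orthonormal_row_sum:
  fixes P :: "'a :: field mat"
  assumes "P \<in> carrier_mat n n" "transpose_mat P * P = 1\<^sub>m n" "i < n" "j < n"
  shows "(\<Sum>k<n. P $$ (i, k) * P $$ (j, k)) = (if i = j then 1 else 0)"
proof -
  have "P * transpose_mat P = 1\<^sub>m n"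
    using mat_mult_left_right_inverse[of "transpose_mat P" n P] assms(1,2) by simp
  then show ?thesis using orthonormal_col_sum[of "transpose_mat P" n i j] assms by simp
qed

lemma mult_conj_mat_diag:
  fixes P :: "'a :: comm_ring_1 mat"
  assumes P: "P \<in> carrier_mat n n" and PP: "transpose_mat P * P = 1\<^sub>m n"
  shows "(P * mat_diag n f * transpose_mat P) * (P * mat_diag n g * transpose_mat P) =
    P * mat_diag n (\<lambda>k. f k * g k) * transpose_mat P"
proof -
  have PT: "transpose_mat P \<in> carrier_mat n n" using P by simp
  let ?D = "mat_diag n f" and ?E = "mat_diag n g" and ?T = "transpose_mat P"
  have c: "P * ?D \<in> carrier_mat n n" "P * ?E \<in> carrier_mat n n" "?E * ?T \<in> carrier_mat n n"
    "P * ?E * ?T \<in> carrier_mat n n" "P * (?E * ?T) \<in> carrier_mat n n"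
    using P PT by (auto intro!: mult_carrier_mat[of _ n n _ n])
  have "?T * (P * ?E * ?T) = ?T * (P * (?E * ?T))"
    using P PT by (subst assoc_mult_mat[of P n n _ n _ n]) auto
  also have "\<dots> = (?T * P) * (?E * ?T)"
    using P PT c by (intro assoc_mult_mat[symmetric]) auto
  also have "\<dots> = ?E * ?T" unfolding PP using c(3) by (rule left_mult_one_mat)
  finally have "P * ?D * ?T * (P * ?E * ?T) = P * ?D * (?E * ?T)"
    using PT c by (subst assoc_mult_mat[of _ n n _ n _ n]) auto
  also have "\<dots> = P * ?D * ?E * ?T"
    using PT c by (intro assoc_mult_mat[symmetric, of _ n n _ n _ n]) auto
  also have "P * ?D * ?E = P * (?D * ?E)"
    using P by (intro assoc_mult_mat[of _ n n _ n _ n]) auto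
  finally show ?thesis by simp
qed

text \<open>Matrices diagonalised by the same \<open>P\<close> multiply entrywise on the diagonal,
  so the Penrose equations reduce to scalar identities. These hold at a zero eigenvalue as well,
  because \<open>inverse 0 = 0\<close>.\<close>

lemma pseudoinverse_conj_mat_diag:
  assumes P: "P \<in> carrier_mat n n" and PP: "transpose_mat P * P = 1\<^sub>m n"
  shows "pseudoinverse (P * mat_diag n f * transpose_mat P) =
    P * mat_diag n (\<lambda>k. inverse (f k)) * transpose_mat P"
proof (rule pseudoinverse_eqI)
  have PT: "transpose_mat P \<in> carrier_mat n n" using P by simp
  have [simp]: "transpose_mat (P * mat_diag n g * transpose_mat P) = P * mat_diag n g * transpose_mat P" for g
    using P by (intro eq_matI) (auto simp: index_conj_mat_diag[OF P] mult_ac simp del: index_mult_mat(1))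
  have inv: "f k * inverse (f k) * f k = f k" "inverse (f k) * f k * inverse (f k) = inverse (f k)" for k
    by (cases "f k = 0"; simp)+
  show "is_pseudoinverse (P * mat_diag n f * transpose_mat P)
      (P * mat_diag n (\<lambda>k. inverse (f k)) * transpose_mat P)"
    using P PT by (auto simp: is_pseudoinverse_def mult_conj_mat_diag[OF P PP] inv)
qed

text \<open>Similarity preserves the characteristic polynomial. This ties the unordered diagonal
  \<open>f\<close> to the sorted list that defines \<open>laplacian_eigenvalue\<close>.\<close>

lemma proots_char_poly_conj_mat_diag:
  fixes P :: "real mat"
  assumes P: "P \<in> carrier_mat n n" and PP: "transpose_mat P * P = 1\<^sub>m n"
  shows "proots (char_poly (P * mat_diag n f * transpose_mat P)) = mset (map f [0..<n])"
proof -
  have PP': "P * transpose_mat P = 1\<^sub>m n"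
    using mat_mult_left_right_inverse[of "transpose_mat P" n P] P PP by simp
  have "similar_mat_wit (P * mat_diag n f * transpose_mat P) (mat_diag n f) P (transpose_mat P)"
    using P PP PP' by (intro similar_mat_witI[of _ _ n]) auto
  then have "char_poly (P * mat_diag n f * transpose_mat P) = char_poly (mat_diag n f)"
    by (intro char_poly_similar) (auto simp: similar_mat_def)
  also have "\<dots> = (\<Prod>a\<leftarrow>diag_mat (mat_diag n f). [:- a, 1:])"
    by (rule char_poly_upper_triangular[of _ n]) (auto simp: mat_diag_def upper_triangular_def)
  also have "diag_mat (mat_diag n f) = map f [0..<n]"
    by (auto simp: diag_mat_def mat_diag_def)
  finally have cp: "char_poly (P * mat_diag n f * transpose_mat P) = (\<Prod>a\<leftarrow>map f [0..<n]. [:- a, 1:])" .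
  have "proots (\<Prod>a\<leftarrow>xs. [:- a, 1:]) = mset xs" for xs :: "real list"
  proof (induction xs)
    case (Cons x xs)
    have "(\<Prod>a\<leftarrow>xs. [:- a, 1:]) \<noteq> 0" by (auto simp: prod_list_zero_iff)
    then show ?case using Cons by (simp add: proots_mult del: mult_pCons_left)
  qed simp
  then show ?thesis unfolding cp .
qed

text \<open>Sorting keeps the multiset, so both sides are the full sum minus \<open>g 0\<close>: the
  least entry of the sorted list is 0, and so is \<open>f k0\<close>. No matching of positions is
  needed.\<close>

lemma sorted_nonneg_sum_tail:
  fixes f :: "nat \<Rightarrow> real"
  assumes k0: "k0 < n" "f k0 = 0" and nonneg: "\<And>k. k < n \<Longrightarrow> f k \<ge> 0"
  shows "(\<Sum>i=2..n. g (sort (map f [0..<n]) ! (i - 1))) = (\<Sum>k\<in>{..<n} - {k0}. g (f k) :: real)"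
proof -
  define xs where "xs = sort (map f [0..<n])"
  have len: "length xs = n" and set: "set xs = f ` {..<n}" and so: "sorted xs"
    by (auto simp: xs_def lessThan_atLeast0)
  have n: "n > 0" using k0 by simp
  have "f k0 \<in> set xs" using set k0(1) by auto
  then obtain i where "i < n" "xs ! i = 0" using len k0(2) by (metis in_set_conv_nth)
  then have "xs ! 0 \<le> 0" using sorted_nth_mono[OF so, of 0 i] len by simp
  moreover have "xs ! 0 \<in> f ` {..<n}" using set len n nth_mem by blast
  ultimately have x0: "xs ! 0 = 0" using nonneg by force
  have "(\<Sum>k<n. g (f k)) = sum_list (map g (map f [0..<n]))"
    by (simp add: sum_list_distinct_conv_sum_set o_def lessThan_atLeast0)
  also have "\<dots> = sum_mset (image_mset g (mset xs))"
    unfolding xs_def by (simp only: mset_sort sum_mset_sum_list[symmetric] mset_map)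
  also have "\<dots> = (\<Sum>i<n. g (xs ! i))"
    by (simp only: mset_map[symmetric] sum_mset_sum_list) (simp add: sum_list_sum_nth len lessThan_atLeast0)
  also have "\<dots> = g (xs ! 0) + (\<Sum>i=1..<n. g (xs ! i))"
    using n by (simp add: lessThan_atLeast0 sum.atLeast_Suc_lessThan)
  \<comment> \<open>The list is indexed from 0, the eigenvalues from 1.\<close>
  also have "(\<Sum>i=1..<n. g (xs ! i)) = (\<Sum>i=2..n. g (xs ! (i - 1)))"
    by (rule sum.reindex_bij_witness[of _ "\<lambda>i. i - 1" Suc]) auto
  finally have "(\<Sum>k<n. g (f k)) = g 0 + (\<Sum>i=2..n. g (xs ! (i - 1)))" by (simp add: x0)
  moreover have "(\<Sum>k<n. g (f k)) = g 0 + (\<Sum>k\<in>{..<n} - {k0}. g (f k))"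
    using sum.remove[of "{..<n}" k0 "\<lambda>k. g (f k)"] k0 by simp
  ultimately show ?thesis by (simp add: xs_def)
qed

section \<open>Hoelder bound with its equality case\<close>

text \<open>Both parts follow from ln t \<le> t - 1, with equality only at t = 1, at t = x/g and t =
  y/g, where g is the weighted geometric mean: the weighted logarithms of these two ratios
  cancel.\<close>

lemma weighted_am_gm:
  fixes x y \<alpha> \<beta> :: real
  assumes "x > 0" "y > 0" "\<alpha> > 0" "\<beta> > 0" "\<alpha> + \<beta> = 1"
  shows "x powr \<alpha> * y powr \<beta> \<le> \<alpha> * x + \<beta> * y"
    and "x powr \<alpha> * y powr \<beta> = \<alpha> * x + \<beta> * y \<longleftrightarrow> x = y"
proof -
  define g where "g = x powr \<alpha> * y powr \<beta>"
  have g: "g > 0" using assms by (simp add: g_def)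
  have lg: "ln g = \<alpha> * ln x + \<beta> * ln y" using assms by (simp add: g_def ln_mult ln_powr)
  have "\<alpha> * ln (x / g) + \<beta> * ln (y / g) = \<alpha> * ln x + \<beta> * ln y - (\<alpha> + \<beta>) * ln g"
    using assms(1,2) g by (simp only: ln_div) (simp add: algebra_simps)
  then have lns: "\<alpha> * ln (x / g) + \<beta> * ln (y / g) = 0" using lg assms(5) by simp
  have lx: "ln (x / g) \<le> x / g - 1" and ly: "ln (y / g) \<le> y / g - 1"
    using assms g by (auto intro!: ln_le_minus_one)
  have ax: "\<alpha> * ln (x / g) \<le> \<alpha> * (x / g - 1)" and ay: "\<beta> * ln (y / g) \<le> \<beta> * (y / g - 1)"
    using lx ly assms by auto
  have id: "\<alpha> * (x / g - 1) + \<beta> * (y / g - 1) = (\<alpha> * x + \<beta> * y) / g - 1"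
    using assms(5) by (simp add: algebra_simps add_divide_distrib)
  have "(\<alpha> * x + \<beta> * y) / g \<ge> 1" using ax ay lns id by linarith
  then show "x powr \<alpha> * y powr \<beta> \<le> \<alpha> * x + \<beta> * y"
    using g unfolding g_def[symmetric] by (simp add: le_divide_eq)
  show "x powr \<alpha> * y powr \<beta> = \<alpha> * x + \<beta> * y \<longleftrightarrow> x = y"
  proof
    assume "x powr \<alpha> * y powr \<beta> = \<alpha> * x + \<beta> * y"
    then have "(\<alpha> * x + \<beta> * y) / g = 1" using g unfolding g_def[symmetric] by simp
    then have "\<alpha> * ln (x / g) = \<alpha> * (x / g - 1)" "\<beta> * ln (y / g) = \<beta> * (y / g - 1)"
      using ax ay lns id by linarith+
    then have "ln (x / g) = x / g - 1" "ln (y / g) = y / g - 1" using assms by auto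
    moreover have "x / g > 0" "y / g > 0" using g assms by auto
    ultimately have "x / g = 1" "y / g = 1" using ln_eq_minus_one by blast+
    then show "x = y" using g by simp
  next
    assume "x = y"
    then show "x powr \<alpha> * y powr \<beta> = \<alpha> * x + \<beta> * y"
      using assms by (simp add: powr_add[symmetric] distrib_right[symmetric])
  qed
qed

text \<open>Hoelder proved by termwise weighted AM-GM on normalised summands. The sum inequality is
  an equality only if every term is, which is how the equality case is obtained.\<close>

lemma sum_powr_lower_bound:
  fixes a :: "'i \<Rightarrow> real" and p :: real
  assumes fin: "finite S" and pos: "\<And>i. i \<in> S \<Longrightarrow> a i > 0" and p: "p > 0"
  defines "R \<equiv> ((\<Sum>i\<in>S. a i) powr (p + 1) / (\<Sum>i\<in>S. a i powr (3 * p + 1))) powr (1 / p)"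
  shows "R \<le> (\<Sum>i\<in>S. a i powr - 2)"
    and "(\<Sum>i\<in>S. a i powr - 2) = R \<longleftrightarrow> (\<forall>i\<in>S. \<forall>j\<in>S. a i = a j)"
proof -
  define U where "U = (\<Sum>i\<in>S. a i powr - 2)"
  define W where "W = (\<Sum>i\<in>S. a i powr (3 * p + 1))"
  define T where "T = (\<Sum>i\<in>S. a i)"
  have "R \<le> U \<and> (U = R \<longleftrightarrow> (\<forall>i\<in>S. \<forall>j\<in>S. a i = a j))"
  proof (cases "S = {}")
    \<comment> \<open>This is the one-vertex graph: by 0 / 0 = 0 and \<open>0 powr _ = 0\<close>
      both sides vanish.\<close>
    case True
    then show ?thesis by (simp add: U_def R_def)
  next
    case False
    have U: "U > 0" and W: "W > 0" and T: "T > 0"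
      unfolding U_def W_def T_def using fin False pos by (auto intro!: sum_pos powr_gt_zero[THEN iffD2] simp: less_imp_neq[symmetric])
    define \<alpha> \<beta> where "\<alpha> = p / (p + 1)" and "\<beta> = 1 / (p + 1)"
    have ab: "\<alpha> > 0" "\<beta> > 0" "\<alpha> + \<beta> = 1" "\<alpha> * (p + 1) = p" "\<beta> * (p + 1) = 1"
      using p by (auto simp: \<alpha>_def \<beta>_def add_divide_distrib[symmetric])
    \<comment> \<open>With this identity the powers of \<open>a i\<close> in the weighted geometric
      mean of \<open>x i\<close> and \<open>y i\<close> combine to exponent 1.\<close>
    have ab': "(3 * p + 1) * \<beta> - 2 * \<alpha> = 1"
      using p by (simp add: \<alpha>_def \<beta>_def diff_divide_distrib[symmetric])
    define K where "K = U powr \<alpha> * W powr \<beta>"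
    have K: "K > 0" using U W by (simp add: K_def)
    define x where "x i = a i powr - 2 / U" for i
    define y where "y i = a i powr (3 * p + 1) / W" for i
    have xy: "x i > 0" "y i > 0" if "i \<in> S" for i using pos[OF that] U W by (auto simp: x_def y_def)
    have prod: "x i powr \<alpha> * y i powr \<beta> = a i / K" if "i \<in> S" for i
    proof -
      have "x i powr \<alpha> * y i powr \<beta> = a i powr (- 2 * \<alpha>) * a i powr ((3 * p + 1) * \<beta>) / K"
        using pos[OF that] U W by (simp add: x_def y_def K_def powr_divide powr_powr)
      also have "a i powr (- 2 * \<alpha>) * a i powr ((3 * p + 1) * \<beta>) = a i powr 1"
        using ab' by (simp add: powr_add[symmetric])
      finally show ?thesis using pos[OF that] by simp
    qed
    have le: "a i / K \<le> \<alpha> * x i + \<beta> * y i"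
      and eq: "a i / K = \<alpha> * x i + \<beta> * y i \<longleftrightarrow> x i = y i" if "i \<in> S" for i
      unfolding prod[OF that, symmetric] using weighted_am_gm[OF xy[OF that] ab(1-3)] by auto
    have sumxy: "(\<Sum>i\<in>S. \<alpha> * x i + \<beta> * y i) = 1"
    proof -
      have "(\<Sum>i\<in>S. x i) = 1" "(\<Sum>i\<in>S. y i) = 1"
        using U W by (simp_all add: x_def y_def sum_divide_distrib[symmetric] U_def[symmetric] W_def[symmetric])
      then show ?thesis using ab(3) by (simp add: sum.distrib sum_distrib_left[symmetric])
    qed
    have sumT: "(\<Sum>i\<in>S. a i / K) = T / K" by (simp add: T_def sum_divide_distrib)
    have TK: "T \<le> K"
      using sum_mono[of S "\<lambda>i. a i / K" "\<lambda>i. \<alpha> * x i + \<beta> * y i"] le K unfolding sumxy sumT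
      by (simp add: divide_le_eq)
    have TK_iff: "T = K \<longleftrightarrow> (\<forall>i\<in>S. x i = y i)"
    proof -
      have "T = K \<longleftrightarrow> (\<Sum>i\<in>S. \<alpha> * x i + \<beta> * y i - a i / K) = 0"
        unfolding sum_subtractf sumxy sumT using K by (auto simp: field_simps)
      also have "\<dots> \<longleftrightarrow> (\<forall>i\<in>S. \<alpha> * x i + \<beta> * y i - a i / K = 0)"
        using le fin by (intro sum_nonneg_eq_0_iff) auto
      also have "\<dots> \<longleftrightarrow> (\<forall>i\<in>S. x i = y i)" using eq by (intro ball_cong refl) (simp add: eq_commute[of _ "a _ / K"] right_minus_eq)
      finally show ?thesis .
    qed
    have const: "(\<forall>i\<in>S. x i = y i) \<longleftrightarrow> (\<forall>i\<in>S. \<forall>j\<in>S. a i = a j)"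
    proof
      assume *: "\<forall>i\<in>S. x i = y i"
      \<comment> \<open>The equation \<open>x i = y i\<close> says a_i^(3p+1) / W = a_i^(-2) / U,
        that is, a_i^(3p+3) = W / U, whose right side is independent of i.\<close>
      have "a i = (W / U) powr (1 / (3 * p + 3))" if "i \<in> S" for i
      proof -
        have ai: "a i > 0" using pos that by auto
        have "a i powr (3 * p + 1) = W / U * a i powr - 2"
          using * that U W by (auto simp: x_def y_def field_simps)
        then have "a i powr (3 * p + 1) * a i powr 2 = W / U * (a i powr - 2 * a i powr 2)" by simp
        then have "a i powr (3 * p + 3) = W / U" using ai
          by (simp add: powr_add[symmetric] add.commute del: powr_numeral)
        then show ?thesis using ai p by (simp add: powr_powr flip: \<open>a i powr (3 * p + 3) = W / U\<close>)
      qed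
      then show "\<forall>i\<in>S. \<forall>j\<in>S. a i = a j" by simp
    next
      assume *: "\<forall>i\<in>S. \<forall>j\<in>S. a i = a j"
      show "\<forall>i\<in>S. x i = y i"
      proof
        fix i assume i: "i \<in> S"
        have eq: "a j = a i" if "j \<in> S" for j using * i that by blast
        have "U = (\<Sum>j\<in>S. a i powr - 2)" "W = (\<Sum>j\<in>S. a i powr (3 * p + 1))"
          unfolding U_def W_def by (intro sum.cong; simp add: eq)+
        then show "x i = y i" using pos[OF i] U W by (simp add: x_def y_def)
      qed
    qed
    \<comment> \<open>\<open>F\<close> is strictly increasing on positive arguments and sends
      \<open>T\<close> to \<open>R\<close> and \<open>K\<close> to \<open>U\<close>, since K^(p+1) =
      U^p W. It thus carries both T \<le> K and its equality case over to \<open>R\<close> and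
      \<open>U\<close>.\<close>
    define F where "F t = (t powr (p + 1) / W) powr (1 / p)" for t
    have FT: "F T = R" by (simp add: F_def R_def T_def W_def)
    have FK: "F K = U"
    proof -
      have "K powr (p + 1) = U powr p * W"
        using U W ab by (simp add: K_def powr_mult powr_powr)
      then show ?thesis using U W p by (simp add: F_def powr_powr)
    qed
    have F_less: "F T < F K" if "T < K"
      unfolding F_def using T W p that
      by (intro powr_less_mono2 divide_strict_right_mono) auto
    have "R \<le> U" using F_less TK FT FK by (cases "T = K") auto
    moreover have "U = R \<longleftrightarrow> T = K" using F_less TK FT FK by (cases "T = K") auto
    ultimately show ?thesis using TK_iff const by simp
  qed
  then show "R \<le> (\<Sum>i\<in>S. a i powr - 2)"
    "(\<Sum>i\<in>S. a i powr - 2) = R \<longleftrightarrow> (\<forall>i\<in>S. \<forall>j\<in>S. a i = a j)"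
    unfolding U_def by auto
qed

section \<open>The graph Laplacian\<close>

context graph
begin

section \<open>Arc counts and isomorphism with the complete graph\<close>

lemma adj_sym: "u \<rightarrow> v \<Longrightarrow> v \<rightarrow> u"
  using sym_arcs by (rule arcs_ends_symmetric)

lemma out_degree_eq_card_adj: "out_degree G u = card {v. u \<rightarrow> v}"
proof -
  have "bij_betw (head G) (out_arcs G u) {v. u \<rightarrow> v}"
    using no_multi_arcs unfolding arc_to_ends_def
    by (auto simp: bij_betw_def inj_on_def arcs_ends_conv image_iff)
  then show ?thesis unfolding out_degree_def by (rule bij_betw_same_card)
qed

lemma finite_arcs_ends: "finite (arcs_ends G)"
  by (simp add: arcs_ends_conv)

text \<open>Counting by fibres: each edge lies under exactly two ordered pairs, which are distinct
  because there are no loops.\<close>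

lemma card_arcs_ends: "card (arcs_ends G) = 2 * card (edges G)"
proof -
  let ?h = "\<lambda>(u, v). {u, v}"
  have im: "edges G = ?h ` arcs_ends G" by (auto simp: edges_def)
  have "card {e \<in> arcs_ends G. ?h e = x} = 2" if "x \<in> ?h ` arcs_ends G" for x
  proof -
    obtain u v where uv: "u \<rightarrow> v" "x = {u, v}" using \<open>x \<in> ?h ` arcs_ends G\<close> by auto
    have "u \<noteq> v" using uv adj_not_same by auto
    moreover have "{e \<in> arcs_ends G. ?h e = x} = {(u, v), (v, u)}"
      using uv adj_sym by (auto simp: doubleton_eq_iff)
    ultimately show ?thesis by auto
  qed
  then have "(\<Sum>x\<in>?h ` arcs_ends G. card {e \<in> arcs_ends G. ?h e = x}) = 2 * card (edges G)"
    by (simp add: im)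
  then show ?thesis
    using sum.image_gen[OF finite_arcs_ends, of "\<lambda>_. 1 :: nat" ?h] by simp
qed

lemma digraph_iso_complete_graph_iff:
  "digraph_iso G (complete_graph (card (verts G))) \<longleftrightarrow>
    (\<forall>u\<in>verts G. \<forall>v\<in>verts G. u \<noteq> v \<longrightarrow> u \<rightarrow> v)"
proof
  assume "digraph_iso G (complete_graph (card (verts G)))"
  then obtain h where h: "digraph_isomorphism h" and eq: "complete_graph (card (verts G)) = app_iso h G"
    unfolding digraph_iso_def by blast
  show "\<forall>u\<in>verts G. \<forall>v\<in>verts G. u \<noteq> v \<longrightarrow> u \<rightarrow> v"
  proof (intro ballI impI)
    fix u v assume uv: "u \<in> verts G" "v \<in> verts G" "u \<noteq> v"
    have "iso_verts h ` verts G = {..<card (verts G)}"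
      using arg_cong[OF eq, of verts] by (simp add: complete_graph_def)
    moreover have "iso_verts h u \<noteq> iso_verts h v" using h uv by simp
    ultimately have "(iso_verts h u, iso_verts h v) \<in> arcs (complete_graph (card (verts G)))"
      using uv by (auto simp: complete_graph_def)
    then obtain a where a: "a \<in> arcs G" "iso_arcs h a = (iso_verts h u, iso_verts h v)"
      unfolding eq by auto
    have "iso_tail h = fst" "iso_head h = snd"
      using arg_cong[OF eq, of tail] arg_cong[OF eq, of head] by (auto simp: complete_graph_def)
    then have "iso_verts h (tail G a) = iso_verts h u" "iso_verts h (head G a) = iso_verts h v"
      using iso_verts_tail[OF h a(1)] iso_verts_head[OF h a(1)] a(2) by auto
    then have "tail G a = u" "head G a = v" using h uv a(1) by auto
    then show "u \<rightarrow> v" using a(1) by (auto simp: arcs_ends_conv)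
  qed
next
  assume adj: "\<forall>u\<in>verts G. \<forall>v\<in>verts G. u \<noteq> v \<longrightarrow> u \<rightarrow> v"
  let ?t = "to_nat_on (verts G)"
  have bij: "bij_betw ?t (verts G) {..<card (verts G)}" by (rule to_nat_on_finite) simp
  have inj: "?t u = ?t v \<longleftrightarrow> u = v" if "u \<in> verts G" "v \<in> verts G" for u v
    using bij_betw_imp_inj_on[OF bij] that by (rule inj_on_eq_iff)
  \<comment> \<open>The isomorphic image must equal \<open>complete_graph\<close> as a record, so
    arcs are sent to pairs of vertex indices and the new tail and head maps have to be
    \<open>fst\<close> and \<open>snd\<close>.\<close>
  define h where "h = \<lparr>iso_verts = ?t, iso_arcs = (\<lambda>a. (?t (tail G a), ?t (head G a))),
    iso_head = snd, iso_tail = fst\<rparr>"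
  have "digraph_isomorphism h"
  proof -
    have "inj_on (\<lambda>a. (?t (tail G a), ?t (head G a))) (arcs G)"
    proof (rule inj_onI)
      fix a b assume "a \<in> arcs G" "b \<in> arcs G"
        "(?t (tail G a), ?t (head G a)) = (?t (tail G b), ?t (head G b))"
      then have "a \<in> arcs G" "b \<in> arcs G" "arc_to_ends G a = arc_to_ends G b"
        using inj by (auto simp: arc_to_ends_def)
      then show "a = b" by (rule no_multi_arcs)
    qed
    then show ?thesis
      using bij_betw_imp_inj_on[OF bij] wf_digraph_axioms
      by (simp add: digraph_isomorphism_def h_def)
  qed
  moreover have "complete_graph (card (verts G)) = app_iso h G"
  proof -
    have "{(i, j). i < card (verts G) \<and> j < card (verts G) \<and> i \<noteq> j} =
      (\<lambda>a. (?t (tail G a), ?t (head G a))) ` arcs G" (is "?L = ?R")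
    proof (intro Set.set_eqI iffI)
      fix x assume "x \<in> ?L"
      then obtain i j where x: "x = (i, j)" "i \<in> {..<card (verts G)}" "j \<in> {..<card (verts G)}" "i \<noteq> j"
        by auto
      then obtain u v where "u \<in> verts G" "v \<in> verts G" "i = ?t u" "j = ?t v"
        using bij unfolding bij_betw_def by blast
      then show "x \<in> ?R" using adj x by (force simp: arcs_ends_conv)
    next
      fix x assume "x \<in> ?R"
      then obtain a where a: "a \<in> arcs G" "x = (?t (tail G a), ?t (head G a))" by auto
      then have "?t (tail G a) \<in> {..<card (verts G)}" "?t (head G a) \<in> {..<card (verts G)}"
        using bij by (auto simp: bij_betw_def)
      then show "x \<in> ?L" using a no_loops[OF a(1)] inj by auto
    qed
    then show ?thesis using bij by (auto simp: complete_graph_def app_iso_def h_def bij_betw_def)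
  qed
  ultimately show "digraph_iso G (complete_graph (card (verts G)))"
    unfolding digraph_iso_def by blast
qed

section \<open>The Laplacian through vertex indices: trace, row sums, quadratic form\<close>

lemma sum_verts: "(\<Sum>v\<in>verts G. f v) = (\<Sum>i<card (verts G). f (from_nat_into (verts G) i))"
  by (rule sum.reindex_bij_betw[symmetric, OF bij_betw_from_nat_into_finite]) simp

lemma from_nat_into_verts: "i < card (verts G) \<Longrightarrow> from_nat_into (verts G) i \<in> verts G"
  using bij_betwE[OF bij_betw_from_nat_into_finite[OF finite_verts]] by auto

lemma from_nat_into_verts_eq_iff:
  "i < card (verts G) \<Longrightarrow> j < card (verts G) \<Longrightarrow>
    from_nat_into (verts G) i = from_nat_into (verts G) j \<longleftrightarrow> i = j"
  using inj_on_eq_iff[OF bij_betw_imp_inj_on[OF bij_betw_from_nat_into_finite[OF finite_verts]]] by auto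

lemma adjacency_mat_sym:
  "i < card (verts G) \<Longrightarrow> j < card (verts G) \<Longrightarrow> adjacency_mat G $$ (i, j) = adjacency_mat G $$ (j, i)"
  by (auto simp: adjacency_mat_def dest: adj_sym)

lemma adjacency_mat_diag: "i < card (verts G) \<Longrightarrow> adjacency_mat G $$ (i, i) = 0"
  by (auto simp: adjacency_mat_def dest: adj_not_same)

lemma out_degree_eq_sum_adjacency_mat:
  assumes "i < card (verts G)"
  shows "real (out_degree G (from_nat_into (verts G) i)) = (\<Sum>j<card (verts G). adjacency_mat G $$ (i, j))"
proof -
  let ?u = "from_nat_into (verts G) i"
  have "(\<Sum>j<card (verts G). adjacency_mat G $$ (i, j)) = (\<Sum>v\<in>verts G. if ?u \<rightarrow> v then 1 else 0)"
    using assms by (simp add: sum_verts adjacency_mat_def)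
  also have "\<dots> = card {v \<in> verts G. ?u \<rightarrow> v}"
    by (simp add: sum.If_cases Int_def)
  also have "{v \<in> verts G. ?u \<rightarrow> v} = {v. ?u \<rightarrow> v}" by (auto dest: adj_in_verts)
  finally show ?thesis by (simp add: out_degree_eq_card_adj)
qed

lemma laplacian_carrier: "laplacian G \<in> carrier_mat (card (verts G)) (card (verts G))"
  unfolding laplacian_def by (rule minus_carrier_mat) (simp add: adjacency_mat_def)

lemma laplacian_index:
  assumes "i < card (verts G)" "j < card (verts G)"
  shows "laplacian G $$ (i, j) =
    (if i = j then \<Sum>l<card (verts G). adjacency_mat G $$ (i, l) else 0) - adjacency_mat G $$ (i, j)"
  using assms by (auto simp: laplacian_def degree_mat_def adjacency_mat_def[of G]
      out_degree_eq_sum_adjacency_mat[unfolded adjacency_mat_def])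

lemma transpose_laplacian: "transpose_mat (laplacian G) = laplacian G"
  using laplacian_carrier
  by (intro eq_matI) (auto simp: laplacian_index adjacency_mat_sym)

lemma laplacian_trace: "(\<Sum>i<card (verts G). laplacian G $$ (i, i)) = 2 * real (card (edges G))"
proof -
  have "(\<Sum>i<card (verts G). laplacian G $$ (i, i)) =
      (\<Sum>i<card (verts G). real (out_degree G (from_nat_into (verts G) i)))"
    by (intro sum.cong) (auto simp: laplacian_index adjacency_mat_diag out_degree_eq_sum_adjacency_mat)
  also have "\<dots> = (\<Sum>u\<in>verts G. real (card {v. u \<rightarrow> v}))"
    by (simp add: sum_verts out_degree_eq_card_adj)
  also have "\<dots> = real (card (SIGMA u:verts G. {v. u \<rightarrow> v}))"
  proof -
    have "finite {v. u \<rightarrow> v}" for u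
      by (rule finite_subset[OF _ finite_verts]) (auto dest: adj_in_verts)
    then show ?thesis by simp
  qed
  also have "(SIGMA u:verts G. {v. u \<rightarrow> v}) = arcs_ends G" by (auto dest: adj_in_verts)
  finally show ?thesis by (simp add: card_arcs_ends)
qed

lemma laplacian_row_sum:
  assumes "i < card (verts G)"
  shows "(\<Sum>j<card (verts G). laplacian G $$ (i, j)) = 0"
proof -
  have "(\<Sum>j<card (verts G). laplacian G $$ (i, j)) =
    (\<Sum>j<card (verts G). (if i = j then \<Sum>l<card (verts G). adjacency_mat G $$ (i, l) else 0) -
      adjacency_mat G $$ (i, j))"
    using assms by (intro sum.cong refl laplacian_index) auto
  then show ?thesis using assms by (simp add: sum_subtractf)
qed

text \<open>Expanding the square yields the degree term twice, once for each index, by symmetry of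
  the adjacency matrix. The right side shows that the form is nonnegative and when it
  vanishes.\<close>

lemma laplacian_quadratic_form:
  fixes x :: "nat \<Rightarrow> real"
  shows "(\<Sum>i<card (verts G). \<Sum>j<card (verts G). laplacian G $$ (i, j) * x i * x j) =
    (\<Sum>i<card (verts G). \<Sum>j<card (verts G). adjacency_mat G $$ (i, j) * (x i - x j)\<^sup>2) / 2"
proof -
  let ?N = "{..<card (verts G)}" and ?a = "\<lambda>i j. adjacency_mat G $$ (i, j)"
  define D where "D = (\<Sum>i\<in>?N. \<Sum>j\<in>?N. ?a i j * (x i)\<^sup>2)"
  define E where "E = (\<Sum>i\<in>?N. \<Sum>j\<in>?N. ?a i j * x i * x j)"
  have D': "D = (\<Sum>i\<in>?N. \<Sum>j\<in>?N. ?a i j * (x j)\<^sup>2)"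
    unfolding D_def by (subst sum.swap) (intro sum.cong refl, simp add: adjacency_mat_sym)
  have "(\<Sum>i\<in>?N. \<Sum>j\<in>?N. laplacian G $$ (i, j) * x i * x j) =
    (\<Sum>i\<in>?N. (\<Sum>j\<in>?N. ?a i j) * x i * x i - (\<Sum>j\<in>?N. ?a i j * x i * x j))"
  proof (intro sum.cong refl)
    fix i assume i: "i \<in> ?N"
    have "(\<Sum>j\<in>?N. laplacian G $$ (i, j) * x i * x j) =
      (\<Sum>j\<in>?N. (if i = j then (\<Sum>l\<in>?N. ?a i l) * x i * x j else 0) - ?a i j * x i * x j)"
      using i by (intro sum.cong refl) (simp add: laplacian_index left_diff_distrib)
    then show "(\<Sum>j\<in>?N. laplacian G $$ (i, j) * x i * x j) =
      (\<Sum>j\<in>?N. ?a i j) * x i * x i - (\<Sum>j\<in>?N. ?a i j * x i * x j)"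
      using i by (simp add: sum_subtractf)
  qed
  also have "\<dots> = D - E"
    by (simp add: sum_subtractf D_def E_def sum_distrib_right power2_eq_square mult.assoc)
  also have "\<dots> = (D + D - 2 * E) / 2" by simp
  also have "D + D - 2 * E = (\<Sum>i\<in>?N. \<Sum>j\<in>?N. ?a i j * (x i - x j)\<^sup>2)"
  proof -
    have "(\<Sum>i\<in>?N. \<Sum>j\<in>?N. ?a i j * (x i - x j)\<^sup>2) =
      (\<Sum>i\<in>?N. \<Sum>j\<in>?N. ?a i j * (x i)\<^sup>2 + ?a i j * (x j)\<^sup>2 - 2 * (?a i j * x i * x j))"
      by (intro sum.cong refl) (simp add: power2_diff algebra_simps)
    also have "\<dots> = D + D - 2 * E"
      unfolding E_def by (subst (2) D') (simp add: D_def sum.distrib sum_subtractf sum_distrib_left)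
    finally show ?thesis by simp
  qed
  finally show ?thesis .
qed

text \<open>A vanishing sum of nonnegative terms forces x to agree across every edge; induction
  along walks spreads this over the connected graph.\<close>

lemma laplacian_kernel_const:
  fixes x :: "nat \<Rightarrow> real"
  assumes conn: "Digraph_Component.connected G"
    and zero: "(\<Sum>i<card (verts G). \<Sum>j<card (verts G). laplacian G $$ (i, j) * x i * x j) = 0"
    and ij: "i < card (verts G)" "j < card (verts G)"
  shows "x i = x j"
proof -
  let ?N = "{..<card (verts G)}" and ?a = "\<lambda>i j. adjacency_mat G $$ (i, j)" and ?t = "to_nat_on (verts G)"
  have nonneg: "?a k l * (x k - x l)\<^sup>2 \<ge> 0" if "k \<in> ?N" "l \<in> ?N" for k l
    using that by (auto simp: adjacency_mat_def)
  have "(\<Sum>i\<in>?N. \<Sum>j\<in>?N. ?a i j * (x i - x j)\<^sup>2) = 0"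
    using zero unfolding laplacian_quadratic_form by simp
  then have 0: "?a k l * (x k - x l)\<^sup>2 = 0" if "k \<in> ?N" "l \<in> ?N" for k l
  proof -
    have "(\<Sum>j\<in>?N. ?a k j * (x k - x j)\<^sup>2) = 0"
      using \<open>(\<Sum>i\<in>?N. \<Sum>j\<in>?N. ?a i j * (x i - x j)\<^sup>2) = 0\<close> that(1) nonneg
      by (subst (asm) sum_nonneg_eq_0_iff) (auto intro!: sum_nonneg)
    then show ?thesis using that nonneg by (subst (asm) sum_nonneg_eq_0_iff) auto
  qed
  have bij: "bij_betw ?t (verts G) ?N" by (rule to_nat_on_finite) simp
  have from_to: "from_nat_into (verts G) (?t u) = u" if "u \<in> verts G" for u
    using that by (simp add: countable_finite)
  have step: "x (?t u) = x (?t v)" if "u \<rightarrow> v" for u v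
  proof -
    have uv: "u \<in> verts G" "v \<in> verts G" using that by (auto dest: adj_in_verts)
    then have t: "?t u \<in> ?N" "?t v \<in> ?N" using bij by (auto simp: bij_betw_def)
    then have "?a (?t u) (?t v) = 1" using that uv by (simp add: adjacency_mat_def from_to)
    then show ?thesis using 0[OF t] by simp
  qed
  have reach: "x (?t u) = x (?t v)" if "u \<rightarrow>\<^sup>* v" for u v
    using that by (induction rule: reachable_induct) (auto dest: step)
  obtain u v where uv: "u \<in> verts G" "v \<in> verts G" "i = ?t u" "j = ?t v"
    using bij ij unfolding bij_betw_def by blast
  have "u \<rightarrow>\<^sup>* v"
    using symmetric_connected_imp_strongly_connected[OF sym_arcs conn] uv by auto
  then show ?thesis using reach uv by simp
qed

theorem laplacian_spectral_decomposition:
  assumes conn: "Digraph_Component.connected G"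
  defines "n \<equiv> card (verts G)"
  obtains P f k0 c where
    "P \<in> carrier_mat n n" "transpose_mat P * P = 1\<^sub>m n"
    "laplacian G = P * mat_diag n f * transpose_mat P"
    "\<And>i k. i < n \<Longrightarrow> k < n \<Longrightarrow> (\<Sum>j<n. laplacian G $$ (i, j) * P $$ (j, k)) = f k * P $$ (i, k)"
    "k0 < n" "f k0 = 0" "\<And>k. k < n \<Longrightarrow> k \<noteq> k0 \<Longrightarrow> f k > 0"
    "\<And>i. i < n \<Longrightarrow> P $$ (i, k0) = c"
    "\<And>k. k < n \<Longrightarrow> k \<noteq> k0 \<Longrightarrow> (\<Sum>i<n. P $$ (i, k)) = 0"
proof -
  let ?L = "laplacian G"
  have L: "?L \<in> carrier_mat n n" using laplacian_carrier by (simp add: n_def)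
  obtain P f where P: "P \<in> carrier_mat n n" "transpose_mat P * P = 1\<^sub>m n"
    "transpose_mat P * ?L * P = mat_diag n f"
    using real_spectral_theorem[OF L transpose_laplacian] by blast
  have PT: "transpose_mat P \<in> carrier_mat n n" using P by simp
  have PP': "P * transpose_mat P = 1\<^sub>m n"
    using mat_mult_left_right_inverse[of "transpose_mat P" n P] P by simp
  have LP: "?L * P = P * mat_diag n f"
  proof -
    have "P * mat_diag n f = P * (transpose_mat P * (?L * P))"
      using P L PT by (simp add: P(3)[symmetric] assoc_mult_mat[of _ n n _ n _ n])
    also have "\<dots> = (P * transpose_mat P) * (?L * P)"
      using P L PT by (intro assoc_mult_mat[symmetric]) auto
    finally show ?thesis using L P by (simp add: PP')
  qed
  have dec: "?L = P * mat_diag n f * transpose_mat P"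
  proof -
    have "P * mat_diag n f * transpose_mat P = ?L * (P * transpose_mat P)"
      unfolding LP[symmetric] using L P(1) PT by (intro assoc_mult_mat) auto
    then show ?thesis using L by (simp add: PP')
  qed
  note O1 = orthonormal_col_sum[OF P(1,2)] and O2 = orthonormal_row_sum[OF P(1,2)]
  have E: "(\<Sum>j<n. ?L $$ (i, j) * P $$ (j, k)) = f k * P $$ (i, k)" if "i < n" "k < n" for i k
    using arg_cong[OF LP, of "\<lambda>M. M $$ (i, k)"] P(1) L that
    by (simp add: mat_diag_mult_right[OF P(1)] scalar_prod_def lessThan_atLeast0 mult.commute)
  have quad: "(\<Sum>i<n. \<Sum>j<n. ?L $$ (i, j) * P $$ (i, k) * P $$ (j, k)) = f k" if "k < n" for k
  proof -
    have "(\<Sum>i<n. \<Sum>j<n. ?L $$ (i, j) * P $$ (i, k) * P $$ (j, k)) =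
      (\<Sum>i<n. P $$ (i, k) * (\<Sum>j<n. ?L $$ (i, j) * P $$ (j, k)))"
      by (simp add: sum_distrib_left mult_ac)
    also have "\<dots> = (\<Sum>i<n. f k * (P $$ (i, k) * P $$ (i, k)))"
      using that by (intro sum.cong refl) (simp add: E)
    finally show ?thesis using that by (simp add: sum_distrib_left[symmetric] O1)
  qed
  have nonneg: "f k \<ge> 0" if "k < n" for k
    unfolding quad[OF that, symmetric] n_def laplacian_quadratic_form
    by (auto intro!: sum_nonneg divide_nonneg_nonneg simp: adjacency_mat_def)
  have const: "P $$ (i, k) = P $$ (j, k)" if "k < n" "f k = 0" "i < n" "j < n" for i j k
    using laplacian_kernel_const[OF conn, of "\<lambda>i. P $$ (i, k)" i j] quad[OF that(1)] that
    unfolding n_def by auto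
  \<comment> \<open>\<open>y k\<close> is the inner product of column k with the all-ones vector.
    That vector lies in the kernel of the symmetric Laplacian, so
    \<open>f k * y k = 0\<close>.\<close>
  define y where "y k = (\<Sum>i<n. P $$ (i, k))" for k
  have fy: "f k * y k = 0" if "k < n" for k
  proof -
    have "f k * y k = (\<Sum>i<n. \<Sum>j<n. ?L $$ (i, j) * P $$ (j, k))"
      unfolding y_def sum_distrib_left using that by (intro sum.cong refl) (simp add: E)
    also have "\<dots> = (\<Sum>j<n. (\<Sum>i<n. ?L $$ (j, i)) * P $$ (j, k))"
    proof (subst sum.swap, intro sum.cong refl)
      fix j assume j: "j \<in> {..<n}"
      have "?L $$ (i, j) = ?L $$ (j, i)" if "i < n" for i
        using arg_cong[OF transpose_laplacian, of "\<lambda>M. M $$ (i, j)"] L j that by auto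
      then show "(\<Sum>i<n. ?L $$ (i, j) * P $$ (j, k)) = (\<Sum>i<n. ?L $$ (j, i)) * P $$ (j, k)"
        by (simp add: sum_distrib_right)
    qed
    also have "\<dots> = 0" using laplacian_row_sum by (simp add: n_def)
    finally show ?thesis .
  qed
  have "verts G \<noteq> {}" using conn by (simp add: connected_conv)
  then have n: "n > 0" by (simp add: n_def card_gt_0_iff)
  \<comment> \<open>This is entry 0 of the all-ones vector expanded in the eigenbasis. As it is 1,
    some coefficient \<open>y k0\<close> is nonzero, and \<open>f k0\<close> must be 0.\<close>
  have "(\<Sum>k<n. P $$ (0, k) * y k) = (\<Sum>j<n. \<Sum>k<n. P $$ (0, k) * P $$ (j, k))"
    unfolding y_def sum_distrib_left by (rule sum.swap)
  also have "\<dots> = 1" using n by (simp add: O2)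
  finally have "(\<Sum>k<n. P $$ (0, k) * y k) \<noteq> 0" by simp
  then obtain k0 where k0: "k0 < n" "y k0 \<noteq> 0"
    by (metis (no_types, lifting) lessThan_iff mult_zero_right sum.neutral)
  have f0: "f k0 = 0" using fy[OF k0(1)] k0(2) by simp
  define c where "c = P $$ (0, k0)"
  have c: "P $$ (i, k0) = c" if "i < n" for i
    using const[OF k0(1) f0 that n] by (simp add: c_def)
  have pos: "f k > 0" if "k < n" "k \<noteq> k0" for k
  proof (rule ccontr)
    assume "\<not> f k > 0"
    then have "f k = 0" using nonneg[OF that(1)] by simp
    \<comment> \<open>A second zero eigenvalue would give another constant column, but two constant
      unit vectors cannot be orthogonal.\<close>
    define d where "d = P $$ (0, k)"
    have d: "P $$ (i, k) = d" if "i < n" for i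
      using const[OF \<open>k < n\<close> \<open>f k = 0\<close> that n] by (simp add: d_def)
    have "real n * (d * c) = 0" using O1[OF that(1) k0(1)] that(2) by (simp add: c d)
    moreover have "real n * (c * c) = 1" using O1[OF k0(1) k0(1)] by (simp add: c)
    moreover have "real n * (d * d) = 1" using O1[OF that(1) that(1)] by (simp add: d)
    ultimately show False by auto
  qed
  have "(\<Sum>i<n. P $$ (i, k)) = 0" if "k < n" "k \<noteq> k0" for k
    using fy[OF that(1)] pos[OF that] by (simp add: y_def)
  then show thesis using that P(1,2) dec E k0(1) f0 pos c by blast
qed

end

text \<open>Summing the squared distances gives n times the trace of the squared pseudoinverse minus
  the sum of all its entries. The trace is the sum of the squared inverse eigenvalues, and the entry
  sum is zero.\<close>

lemma (in graph) biharmonic_index_conj_mat_diag: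
  assumes P: "P \<in> carrier_mat (card (verts G)) (card (verts G))"
      "transpose_mat P * P = 1\<^sub>m (card (verts G))"
    and L: "laplacian G = P * mat_diag (card (verts G)) f * transpose_mat P"
    and k0: "k0 < card (verts G)" "f k0 = 0"
    and sum0: "\<And>k. k < card (verts G) \<Longrightarrow> k \<noteq> k0 \<Longrightarrow> (\<Sum>i<card (verts G). P $$ (i, k)) = 0"
  shows "biharmonic_index G =
    card (verts G) * (\<Sum>k\<in>{..<card (verts G)} - {k0}. (inverse (f k))\<^sup>2)"
proof -
  let ?n = "card (verts G)" and ?N = "{..<card (verts G)}"
  define g where "g k = (inverse (f k))\<^sup>2" for k
  define M where "M = pseudoinverse (laplacian G) * pseudoinverse (laplacian G)"
  have M: "M = P * mat_diag ?n g * transpose_mat P"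
    unfolding M_def L pseudoinverse_conj_mat_diag[OF P] mult_conj_mat_diag[OF P]
    by (simp add: g_def[abs_def] power2_eq_square)
  have M_index: "M $$ (i, j) = (\<Sum>k<?n. g k * P $$ (i, k) * P $$ (j, k))" if "i < ?n" "j < ?n" for i j
    unfolding M using P(1) that by (rule index_conj_mat_diag)
  have trace: "(\<Sum>i<?n. M $$ (i, i)) = (\<Sum>k<?n. g k)"
  proof -
    have "(\<Sum>i<?n. M $$ (i, i)) = (\<Sum>i<?n. \<Sum>k<?n. g k * (P $$ (i, k) * P $$ (i, k)))"
      by (intro sum.cong refl) (simp add: M_index mult.assoc)
    also have "\<dots> = (\<Sum>k<?n. \<Sum>i<?n. g k * (P $$ (i, k) * P $$ (i, k)))" by (rule sum.swap)
    finally show ?thesis by (simp add: sum_distrib_left[symmetric] orthonormal_col_sum[OF P])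
  qed
  have total: "(\<Sum>i<?n. \<Sum>j<?n. M $$ (i, j)) = 0"
  proof -
    have "(\<Sum>i<?n. \<Sum>j<?n. M $$ (i, j)) = (\<Sum>i<?n. \<Sum>j<?n. \<Sum>k<?n. g k * P $$ (i, k) * P $$ (j, k))"
      by (intro sum.cong refl) (simp add: M_index)
    also have "\<dots> = (\<Sum>i<?n. \<Sum>k<?n. \<Sum>j<?n. g k * P $$ (i, k) * P $$ (j, k))"
      by (rule sum.cong[OF refl], rule sum.swap)
    also have "\<dots> = (\<Sum>i<?n. \<Sum>k<?n. g k * P $$ (i, k) * (\<Sum>j<?n. P $$ (j, k)))"
      by (simp add: sum_distrib_left)
    also have "\<dots> = 0"
    proof (intro sum.neutral ballI)
      fix i k assume "k \<in> ?N"
      then show "g k * P $$ (i, k) * (\<Sum>j<?n. P $$ (j, k)) = 0"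
        \<comment> \<open>Column \<open>k0\<close> need not sum to zero, but its weight is
          \<open>inverse 0\<close> squared, which is 0.\<close>
        using sum0[of k] k0(2) by (cases "k = k0") (auto simp: g_def)
    qed
    finally show ?thesis .
  qed
  have bij: "bij_betw (to_nat_on (verts G)) (verts G) ?N" by (rule to_nat_on_finite) simp
  have "biharmonic_index G =
      (\<Sum>u\<in>verts G. \<Sum>v\<in>verts G. (\<lambda>i j. M $$ (i, i) + M $$ (j, j) - 2 * M $$ (i, j))
        (to_nat_on (verts G) u) (to_nat_on (verts G) v)) / 2"
    by (simp add: biharmonic_index_def biharmonic_dist_sq_def Let_def M_def)
  also have "\<dots> = (\<Sum>i<?n. \<Sum>j<?n. M $$ (i, i) + M $$ (j, j) - 2 * M $$ (i, j)) / 2"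
    unfolding sum.reindex_bij_betw[OF bij, of "\<lambda>j. M $$ (i, i) + M $$ (j, j) - 2 * M $$ (i, j)" for i]
      sum.reindex_bij_betw[OF bij, of "\<lambda>i. \<Sum>j<?n. M $$ (i, i) + M $$ (j, j) - 2 * M $$ (i, j)"] ..
  also have "\<dots> = ?n * (\<Sum>i<?n. M $$ (i, i)) - (\<Sum>i<?n. \<Sum>j<?n. M $$ (i, j))"
    by (simp add: sum.distrib sum_subtractf sum_distrib_left[symmetric])
  also have "\<dots> = ?n * (\<Sum>k<?n. g k)" by (simp add: trace total)
  also have "(\<Sum>k<?n. g k) = (\<Sum>k\<in>?N - {k0}. g k)"
    using sum.remove[of ?N k0 g] k0 by (simp add: g_def)
  finally show ?thesis by (simp add: g_def)
qed

section \<open>The bound for a connected graph and its equality case\<close>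

theorem theorem3p3:
  fixes G :: "('a, 'b) pre_digraph" and p :: real and n m :: nat
  assumes "p > 0"
    and "graph G"
    and "Digraph_Component.connected G"
    and "card (verts G) = n"
    and "card (edges G) = m"
  shows "biharmonic_index G \<ge>
      real n * ((2 * real m) powr (p + 1) /
        (\<Sum>i=2..n. laplacian_eigenvalue G i powr (3 * p + 1))) powr (1 / p)
    \<and> (biharmonic_index G =
      real n * ((2 * real m) powr (p + 1) /
        (\<Sum>i=2..n. laplacian_eigenvalue G i powr (3 * p + 1))) powr (1 / p)
      \<longleftrightarrow> digraph_iso G (complete_graph n))"
proof -
  interpret graph G by (rule assms(2))
  note n = assms(4)
  obtain P f k0 c where P: "P \<in> carrier_mat n n" "transpose_mat P * P = 1\<^sub>m n"
    and L: "laplacian G = P * mat_diag n f * transpose_mat P"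
    and E: "\<And>i k. i < n \<Longrightarrow> k < n \<Longrightarrow> (\<Sum>j<n. laplacian G $$ (i, j) * P $$ (j, k)) = f k * P $$ (i, k)"
    and k0: "k0 < n" "f k0 = 0" and pos: "\<And>k. k < n \<Longrightarrow> k \<noteq> k0 \<Longrightarrow> f k > 0"
    and c: "\<And>i. i < n \<Longrightarrow> P $$ (i, k0) = c"
    and sum0: "\<And>k. k < n \<Longrightarrow> k \<noteq> k0 \<Longrightarrow> (\<Sum>i<n. P $$ (i, k)) = 0"
    by (rule laplacian_spectral_decomposition[OF assms(3), unfolded n]) (rule that)
  let ?S = "{..<n} - {k0}"
  note O1 = orthonormal_col_sum[OF P] and O2 = orthonormal_row_sum[OF P]
  have L_index: "laplacian G $$ (i, j) = (\<Sum>k<n. f k * P $$ (i, k) * P $$ (j, k))" if "i < n" "j < n" for i j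
    unfolding L using P(1) that by (rule index_conj_mat_diag)

  have BH: "biharmonic_index G = n * (\<Sum>k\<in>?S. f k powr - 2)"
  proof -
    have "(inverse (f k))\<^sup>2 = f k powr - 2" if "k \<in> ?S" for k
      using pos[of k] that by (simp add: powr_minus power_inverse)
    then show ?thesis
      using biharmonic_index_conj_mat_diag[of P f k0, unfolded n, OF P L k0 sum0] by simp
  qed

  have sum_f: "(\<Sum>k\<in>?S. f k) = 2 * real m"
  proof -
    have "2 * real m = (\<Sum>i<n. \<Sum>k<n. f k * (P $$ (i, k) * P $$ (i, k)))"
      unfolding laplacian_trace[unfolded n assms(5), symmetric]
      by (intro sum.cong refl) (simp add: L_index mult.assoc)
    also have "\<dots> = (\<Sum>k<n. \<Sum>i<n. f k * (P $$ (i, k) * P $$ (i, k)))" by (rule sum.swap)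
    also have "\<dots> = (\<Sum>k<n. f k)" by (simp add: sum_distrib_left[symmetric] O1)
    also have "\<dots> = (\<Sum>k\<in>?S. f k)" using sum.remove[of "{..<n}" k0 f] k0 by simp
    finally show ?thesis by simp
  qed

  have nonneg: "f k \<ge> 0" if "k < n" for k using pos[OF that] k0 by (cases "k = k0") auto
  have ev: "(\<Sum>i=2..n. laplacian_eigenvalue G i powr (3 * p + 1)) = (\<Sum>k\<in>?S. f k powr (3 * p + 1))"
    unfolding laplacian_eigenvalue_def L proots_char_poly_conj_mat_diag[OF P] sorted_list_of_multiset_mset
    using k0 nonneg by (rule sorted_nonneg_sum_tail)

  have complete_iff: "(\<forall>k\<in>?S. \<forall>l\<in>?S. f k = f l) \<longleftrightarrow> digraph_iso G (complete_graph n)"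
    unfolding digraph_iso_complete_graph_iff[unfolded n]
  proof
    assume eq: "\<forall>k\<in>?S. \<forall>l\<in>?S. f k = f l"
    show "\<forall>u\<in>verts G. \<forall>v\<in>verts G. u \<noteq> v \<longrightarrow> u \<rightarrow>\<^bsub>G\<^esub> v"
    proof (intro ballI impI)
      fix u v assume uv: "u \<in> verts G" "v \<in> verts G" "u \<noteq> v"
      obtain i j where ij: "i < n" "j < n" "u = from_nat_into (verts G) i" "v = from_nat_into (verts G) j"
        using uv(1,2) bij_betw_from_nat_into_finite[OF finite_verts] unfolding bij_betw_def n by blast
      then have "i \<noteq> j" using uv by auto
      \<comment> \<open>Two distinct indices cannot both be \<open>k0\<close>, so a nonzero
        eigenvalue exists.\<close>
      then obtain s where s: "s \<in> ?S" using ij by (cases "i = k0") auto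
      have fs: "f k = f s" if "k \<in> ?S" for k using eq s that by blast
      have c0: "c \<noteq> 0" using O1[OF k0(1) k0(1)] c by auto
      have "laplacian G $$ (i, j) = (\<Sum>k\<in>?S. f k * (P $$ (i, k) * P $$ (j, k)))"
        using k0 ij by (simp add: L_index sum.remove[of "{..<n}" k0] mult.assoc)
      also have "\<dots> = f s * (\<Sum>k\<in>?S. P $$ (i, k) * P $$ (j, k))"
        unfolding sum_distrib_left by (intro sum.cong refl) (simp add: fs)
      \<comment> \<open>Rows i and j of \<open>P\<close> are orthogonal, so the terms outside
        \<open>k0\<close> add up to minus the \<open>k0\<close> term, which is
        \<open>c * c\<close>.\<close>
      also have "(\<Sum>k\<in>?S. P $$ (i, k) * P $$ (j, k)) = - (c * c)"
        using O2[OF ij(1,2)] \<open>i \<noteq> j\<close> k0(1) ij c by (simp add: sum.remove[of "{..<n}" k0])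
      finally have "laplacian G $$ (i, j) \<noteq> 0" using c0 pos[of s] s by auto
      then have "adjacency_mat G $$ (i, j) \<noteq> 0"
        using ij \<open>i \<noteq> j\<close> by (simp add: laplacian_index n)
      then show "u \<rightarrow>\<^bsub>G\<^esub> v" using ij by (auto simp: adjacency_mat_def n split: if_splits)
    qed
  next
    assume adj: "\<forall>u\<in>verts G. \<forall>v\<in>verts G. u \<noteq> v \<longrightarrow> u \<rightarrow>\<^bsub>G\<^esub> v"
    have a: "adjacency_mat G $$ (i, j) = 1 - (if i = j then 1 else 0)" if "i < n" "j < n" for i j
    proof (cases "i = j")
      case True
      then show ?thesis using that adjacency_mat_diag by (simp add: n)
    next
      case False
      then have "from_nat_into (verts G) i \<rightarrow>\<^bsub>G\<^esub> from_nat_into (verts G) j"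
        using adj that from_nat_into_verts from_nat_into_verts_eq_iff by (simp add: n)
      then show ?thesis using that False by (simp add: adjacency_mat_def n)
    qed
    have Lc: "laplacian G $$ (i, j) = (if i = j then real n else 0) - 1" if "i < n" "j < n" for i j
    proof -
      have "(\<Sum>l<n. adjacency_mat G $$ (i, l)) = (\<Sum>l<n. 1 - (if i = l then 1 else 0))"
        using that by (intro sum.cong refl) (simp add: a)
      also have "\<dots> = real n - 1" using that by (simp add: sum_subtractf)
      finally have row: "(\<Sum>l<n. adjacency_mat G $$ (i, l)) = real n - 1" .
      show ?thesis unfolding laplacian_index[unfolded n, OF that] row using that by (simp add: a)
    qed
    have "f k = real n" if k: "k \<in> ?S" for k
    proof -
      have "\<exists>i<n. P $$ (i, k) \<noteq> 0"
      proof (rule ccontr)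
        assume "\<not> (\<exists>i<n. P $$ (i, k) \<noteq> 0)"
        then have "(\<Sum>i<n. P $$ (i, k) * P $$ (i, k)) = 0" by simp
        then show False using O1[of k k] k by simp
      qed
      then obtain i where i: "i < n" "P $$ (i, k) \<noteq> 0" by blast
      \<comment> \<open>The Laplacian of the complete graph is n I - J, and J annihilates column k
        because its entries sum to zero. Comparison at a nonzero entry gives the eigenvalue
        n.\<close>
      have "f k * P $$ (i, k) = (\<Sum>j<n. (if i = j then real n * P $$ (j, k) else 0) - P $$ (j, k))"
        using i(1) k by (subst E[symmetric]) (auto intro!: sum.cong simp: Lc algebra_simps)
      also have "\<dots> = real n * P $$ (i, k)" using i(1) k sum0[of k] by (simp add: sum_subtractf)
      finally show ?thesis using i(2) by simp
    qed
    then show "\<forall>k\<in>?S. \<forall>l\<in>?S. f k = f l" by simp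
  qed

  have "n > 0" using k0 by simp
  moreover have "f k > 0" if "k \<in> ?S" for k using pos that by auto
  then have "((\<Sum>k\<in>?S. f k) powr (p + 1) / (\<Sum>k\<in>?S. f k powr (3 * p + 1))) powr (1 / p)
      \<le> (\<Sum>k\<in>?S. f k powr - 2)"
    "(\<Sum>k\<in>?S. f k powr - 2) =
      ((\<Sum>k\<in>?S. f k) powr (p + 1) / (\<Sum>k\<in>?S. f k powr (3 * p + 1))) powr (1 / p)
      \<longleftrightarrow> (\<forall>k\<in>?S. \<forall>l\<in>?S. f k = f l)"
    using sum_powr_lower_bound[of ?S f p] assms(1) by blast+
  ultimately show ?thesis
    unfolding BH ev sum_f complete_iff[symmetric] by (simp add: mult_le_cancel_left_pos)
qed

end
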